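(* Let $G$ be a group with commuting conjugates, i.e. such that for every finitely generated subgroup $H\le G$ there exists an element $f\in G$ such that every element of $H$ commutes with every element of $H^f:=f^{-1}Hf$. Then $H^2_b(G;\mathbf{R})=0$.
   Context: All groups are discrete. $H^2_b(G;\mathbf{R})$ is the second bounded cohomology of $G$ with trivial real coefficients: the space of bounded functions $\omega:G^2\to\mathbf{R}$ satisfying $\omega(g_2,g_3)-\omega(g_1g_2,g_3)+\omega(g_1,g_2g_3)-\omega(g_1,g_2)=0$ for all $g_1,g_2,g_3\in G$ (bounded 2-cocycles), modulo the functions of the form $(g,h)\mapsto \phi(g)+\phi(h)-\phi(gh)$ with $\phi:G\to\mathbf{R}$ bounded. *)

theory Defs
  imports "HOL-Analysis.Elementary_Normed_Spaces" "HOL-Algebra.Elementary_Groups"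
begin

definition finitely_generated_subgroup :: "('a, 'b) monoid_scheme \<Rightarrow> 'a set \<Rightarrow> bool" where
  "finitely_generated_subgroup G H \<longleftrightarrow>
     subgroup H G \<and> (\<exists>S. finite S \<and> S \<subseteq> carrier G \<and> H = generate G S)"

text \<open>The set \<open>(inv f <# H) #> f\<close> is \<open>H\<^sup>f = f\<^sup>-\<^sup>1 H f\<close>.\<close>

definition commuting_conjugates :: "('a, 'b) monoid_scheme \<Rightarrow> bool" where
  "commuting_conjugates G \<longleftrightarrow>
     (\<forall>H. finitely_generated_subgroup G H \<longrightarrow>
       (\<exists>f\<in>carrier G. \<forall>x\<in>H. \<forall>y\<in>(inv\<^bsub>G\<^esub> f <#\<^bsub>G\<^esub> H) #>\<^bsub>G\<^esub> f. x \<otimes>\<^bsub>G\<^esub> y = y \<otimes>\<^bsub>G\<^esub> x))"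

text \<open>Functions on \<open>G \<times> G\<close> are represented by functions on the type that are
  \<^const>\<open>undefined\<close> off \<open>carrier G \<times> carrier G\<close>, so that equality of cochains is equality on
  the carrier.\<close>

definition bounded_2_cocycles :: "('a, 'b) monoid_scheme \<Rightarrow> ('a \<times> 'a \<Rightarrow> real) set" where
  "bounded_2_cocycles G =
     {\<omega> \<in> (carrier G \<times> carrier G) \<rightarrow>\<^sub>E UNIV.
        bounded (\<omega> ` (carrier G \<times> carrier G)) \<and>
        (\<forall>g1\<in>carrier G. \<forall>g2\<in>carrier G. \<forall>g3\<in>carrier G.
           \<omega> (g2, g3) - \<omega> (g1 \<otimes>\<^bsub>G\<^esub> g2, g3) + \<omega> (g1, g2 \<otimes>\<^bsub>G\<^esub> g3) - \<omega> (g1, g2) = 0)}"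

definition bounded_2_coboundaries :: "('a, 'b) monoid_scheme \<Rightarrow> ('a \<times> 'a \<Rightarrow> real) set" where
  "bounded_2_coboundaries G =
     {(\<lambda>(g, h)\<in>carrier G \<times> carrier G. \<phi> g + \<phi> h - \<phi> (g \<otimes>\<^bsub>G\<^esub> h)) | \<phi> :: 'a \<Rightarrow> real.
        bounded (\<phi> ` carrier G)}"

definition bounded_2_cocycle_group :: "('a, 'b) monoid_scheme \<Rightarrow> ('a \<times> 'a \<Rightarrow> real) monoid" where
  "bounded_2_cocycle_group G =
     \<lparr>carrier = bounded_2_cocycles G,
      mult = (\<lambda>\<omega> \<eta>. \<lambda>p\<in>carrier G \<times> carrier G. \<omega> p + \<eta> p),
      one = (\<lambda>p\<in>carrier G \<times> carrier G. 0)\<rparr>"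

text \<open>Only the additive group of the real vector space \<open>H\<^sup>2\<^sub>b(G;\<real>)\<close> is recorded.  The scalar
  multiplication, which is well defined on cosets by the closure lemmas below, plays no part in
  the vanishing of the quotient.\<close>

definition second_bounded_cohomology ::
    "('a, 'b) monoid_scheme \<Rightarrow> ('a \<times> 'a \<Rightarrow> real) set monoid" where
  "second_bounded_cohomology G = bounded_2_cocycle_group G Mod bounded_2_coboundaries G"

lemma bounded_2_cocycles_iff:
  "\<omega> \<in> bounded_2_cocycles G \<longleftrightarrow>
     \<omega> \<in> extensional (carrier G \<times> carrier G) \<and>
     (\<exists>C. \<forall>g\<in>carrier G. \<forall>h\<in>carrier G. \<bar>\<omega> (g, h)\<bar> \<le> C) \<and>
     (\<forall>g1\<in>carrier G. \<forall>g2\<in>carrier G. \<forall>g3\<in>carrier G.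
        \<omega> (g2, g3) - \<omega> (g1 \<otimes>\<^bsub>G\<^esub> g2, g3) + \<omega> (g1, g2 \<otimes>\<^bsub>G\<^esub> g3) - \<omega> (g1, g2) = 0)"
  by (auto simp: bounded_2_cocycles_def PiE_def bounded_iff)

context group
begin

lemma bounded_2_cocycles_add:
  assumes "\<omega> \<in> bounded_2_cocycles G" "\<eta> \<in> bounded_2_cocycles G"
  shows "(\<lambda>p\<in>carrier G \<times> carrier G. \<omega> p + \<eta> p) \<in> bounded_2_cocycles G"
proof -
  obtain C D where "\<forall>g\<in>carrier G. \<forall>h\<in>carrier G. \<bar>\<omega> (g, h)\<bar> \<le> C"
    and "\<forall>g\<in>carrier G. \<forall>h\<in>carrier G. \<bar>\<eta> (g, h)\<bar> \<le> D"
    using assms unfolding bounded_2_cocycles_iff by blast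
  then have "\<forall>g\<in>carrier G. \<forall>h\<in>carrier G. \<bar>\<omega> (g, h) + \<eta> (g, h)\<bar> \<le> C + D"
    by (meson abs_triangle_ineq add_mono order_trans)
  moreover have "\<omega> (g2, g3) + \<eta> (g2, g3) - (\<omega> (g1 \<otimes> g2, g3) + \<eta> (g1 \<otimes> g2, g3))
      + (\<omega> (g1, g2 \<otimes> g3) + \<eta> (g1, g2 \<otimes> g3)) - (\<omega> (g1, g2) + \<eta> (g1, g2)) = 0"
    if "g1 \<in> carrier G" "g2 \<in> carrier G" "g3 \<in> carrier G" for g1 g2 g3
  proof -
    have "\<omega> (g2, g3) - \<omega> (g1 \<otimes> g2, g3) + \<omega> (g1, g2 \<otimes> g3) - \<omega> (g1, g2) = 0"
      "\<eta> (g2, g3) - \<eta> (g1 \<otimes> g2, g3) + \<eta> (g1, g2 \<otimes> g3) - \<eta> (g1, g2) = 0"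
      using assms that unfolding bounded_2_cocycles_iff by blast+
    then show ?thesis by linarith
  qed
  ultimately show ?thesis unfolding bounded_2_cocycles_iff by auto
qed

lemma bounded_2_cocycles_scale:
  assumes "\<omega> \<in> bounded_2_cocycles G"
  shows "(\<lambda>p\<in>carrier G \<times> carrier G. c * \<omega> p) \<in> bounded_2_cocycles G"
proof -
  obtain C where "\<forall>g\<in>carrier G. \<forall>h\<in>carrier G. \<bar>\<omega> (g, h)\<bar> \<le> C"
    using assms unfolding bounded_2_cocycles_iff by blast
  then have "\<forall>g\<in>carrier G. \<forall>h\<in>carrier G. \<bar>c * \<omega> (g, h)\<bar> \<le> \<bar>c\<bar> * C"
    by (simp add: abs_mult mult_left_mono)
  moreover have "c * \<omega> (g2, g3) - c * \<omega> (g1 \<otimes> g2, g3) + c * \<omega> (g1, g2 \<otimes> g3) - c * \<omega> (g1, g2) = 0"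
    if "g1 \<in> carrier G" "g2 \<in> carrier G" "g3 \<in> carrier G" for g1 g2 g3
  proof -
    have "\<omega> (g2, g3) - \<omega> (g1 \<otimes> g2, g3) + \<omega> (g1, g2 \<otimes> g3) - \<omega> (g1, g2) = 0"
      using assms that unfolding bounded_2_cocycles_iff by blast
    then have "c * (\<omega> (g2, g3) - \<omega> (g1 \<otimes> g2, g3) + \<omega> (g1, g2 \<otimes> g3) - \<omega> (g1, g2)) = 0"
      by simp
    then show ?thesis by (simp only: right_diff_distrib distrib_left)
  qed
  ultimately show ?thesis unfolding bounded_2_cocycles_iff by auto
qed

lemma bounded_2_coboundaries_subset: "bounded_2_coboundaries G \<subseteq> bounded_2_cocycles G"
proof
  fix \<omega> assume "\<omega> \<in> bounded_2_coboundaries G"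
  then obtain \<phi> :: "'a \<Rightarrow> real" where \<omega>:
      "\<omega> = (\<lambda>(g, h)\<in>carrier G \<times> carrier G. \<phi> g + \<phi> h - \<phi> (g \<otimes> h))"
    and b: "bounded (\<phi> ` carrier G)"
    unfolding bounded_2_coboundaries_def by blast
  obtain C where C: "\<And>g. g \<in> carrier G \<Longrightarrow> \<bar>\<phi> g\<bar> \<le> C"
    using b by (auto simp: bounded_iff)
  have "\<bar>\<phi> g + \<phi> h - \<phi> (g \<otimes> h)\<bar> \<le> 3 * C" if "g \<in> carrier G" "h \<in> carrier G" for g h
    using C[OF that(1)] C[OF that(2)] C[OF m_closed[OF that]] by linarith
  then show "\<omega> \<in> bounded_2_cocycles G"
    unfolding bounded_2_cocycles_iff \<omega> by (auto simp: m_assoc)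
qed

lemma bounded_2_coboundaries_add:
  assumes "\<omega> \<in> bounded_2_coboundaries G" "\<eta> \<in> bounded_2_coboundaries G"
  shows "(\<lambda>p\<in>carrier G \<times> carrier G. \<omega> p + \<eta> p) \<in> bounded_2_coboundaries G"
proof -
  obtain \<phi> \<psi> :: "'a \<Rightarrow> real" where
      eq: "\<omega> = (\<lambda>(g, h)\<in>carrier G \<times> carrier G. \<phi> g + \<phi> h - \<phi> (g \<otimes> h))"
      "\<eta> = (\<lambda>(g, h)\<in>carrier G \<times> carrier G. \<psi> g + \<psi> h - \<psi> (g \<otimes> h))"
    and b: "bounded (\<phi> ` carrier G)" "bounded (\<psi> ` carrier G)"
    using assms unfolding bounded_2_coboundaries_def by blast
  have "bounded ((\<lambda>g. \<phi> g + \<psi> g) ` carrier G)"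
    using b by (rule bounded_plus_comp)
  then show ?thesis
    unfolding bounded_2_coboundaries_def eq
    by (intro CollectI exI[of _ "\<lambda>g. \<phi> g + \<psi> g"]) (auto simp: fun_eq_iff restrict_def)
qed

lemma bounded_2_coboundaries_scale:
  assumes "\<omega> \<in> bounded_2_coboundaries G"
  shows "(\<lambda>p\<in>carrier G \<times> carrier G. c * \<omega> p) \<in> bounded_2_coboundaries G"
proof -
  obtain \<phi> :: "'a \<Rightarrow> real" where
      eq: "\<omega> = (\<lambda>(g, h)\<in>carrier G \<times> carrier G. \<phi> g + \<phi> h - \<phi> (g \<otimes> h))"
    and b: "bounded (\<phi> ` carrier G)"
    using assms unfolding bounded_2_coboundaries_def by blast
  have "bounded ((\<lambda>g. c * \<phi> g) ` carrier G)"
    using bounded_scaleR_comp[OF b, of c] by simp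
  then show ?thesis
    unfolding bounded_2_coboundaries_def eq
    by (intro CollectI exI[of _ "\<lambda>g. c * \<phi> g"]) (auto simp: fun_eq_iff restrict_def algebra_simps)
qed

lemma comm_group_bounded_2_cocycle_group: "comm_group (bounded_2_cocycle_group G)"
proof (rule comm_groupI)
  show "\<one>\<^bsub>bounded_2_cocycle_group G\<^esub> \<in> carrier (bounded_2_cocycle_group G)"
    by (auto simp: bounded_2_cocycle_group_def bounded_2_cocycles_iff)
next
  fix \<omega> assume \<omega>: "\<omega> \<in> carrier (bounded_2_cocycle_group G)"
  then have "\<omega> \<in> extensional (carrier G \<times> carrier G)"
    by (simp add: bounded_2_cocycle_group_def bounded_2_cocycles_iff)
  then show "\<one>\<^bsub>bounded_2_cocycle_group G\<^esub> \<otimes>\<^bsub>bounded_2_cocycle_group G\<^esub> \<omega> = \<omega>"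
    by (auto simp: bounded_2_cocycle_group_def fun_eq_iff restrict_def extensional_def)
  show "\<exists>\<eta>\<in>carrier (bounded_2_cocycle_group G).
      \<eta> \<otimes>\<^bsub>bounded_2_cocycle_group G\<^esub> \<omega> = \<one>\<^bsub>bounded_2_cocycle_group G\<^esub>"
    using \<omega> bounded_2_cocycles_scale[of \<omega> "-1"]
    by (intro bexI[of _ "\<lambda>p\<in>carrier G \<times> carrier G. - 1 * \<omega> p"])
      (auto simp: bounded_2_cocycle_group_def fun_eq_iff restrict_def)
next
  fix \<omega> \<eta> assume "\<omega> \<in> carrier (bounded_2_cocycle_group G)" "\<eta> \<in> carrier (bounded_2_cocycle_group G)"
  then show "\<omega> \<otimes>\<^bsub>bounded_2_cocycle_group G\<^esub> \<eta> \<in> carrier (bounded_2_cocycle_group G)"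
    by (simp add: bounded_2_cocycle_group_def bounded_2_cocycles_add)
qed (auto simp: bounded_2_cocycle_group_def fun_eq_iff restrict_def)

lemma subgroup_bounded_2_coboundaries:
  "subgroup (bounded_2_coboundaries G) (bounded_2_cocycle_group G)"
proof -
  interpret Z: comm_group "bounded_2_cocycle_group G"
    by (rule comm_group_bounded_2_cocycle_group)
  show ?thesis
  proof (rule Z.subgroupI)
    show "bounded_2_coboundaries G \<subseteq> carrier (bounded_2_cocycle_group G)"
      using bounded_2_coboundaries_subset by (simp add: bounded_2_cocycle_group_def)
    have "bounded ((\<lambda>g. 0::real) ` carrier G)"
      by (auto simp: bounded_iff)
    then show "bounded_2_coboundaries G \<noteq> {}"
      unfolding bounded_2_coboundaries_def by blast
  next
    fix \<omega> assume \<omega>: "\<omega> \<in> bounded_2_coboundaries G"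
    let ?\<eta> = "\<lambda>p\<in>carrier G \<times> carrier G. - 1 * \<omega> p"
    have \<eta>: "?\<eta> \<in> bounded_2_coboundaries G"
      using \<omega> by (rule bounded_2_coboundaries_scale)
    have "inv\<^bsub>bounded_2_cocycle_group G\<^esub> \<omega> = ?\<eta>"
    proof (rule Z.inv_equality)
      show "?\<eta> \<otimes>\<^bsub>bounded_2_cocycle_group G\<^esub> \<omega> = \<one>\<^bsub>bounded_2_cocycle_group G\<^esub>"
        by (auto simp: bounded_2_cocycle_group_def fun_eq_iff restrict_def)
    qed (use \<omega> \<eta> bounded_2_coboundaries_subset in \<open>auto simp: bounded_2_cocycle_group_def\<close>)
    then show "inv\<^bsub>bounded_2_cocycle_group G\<^esub> \<omega> \<in> bounded_2_coboundaries G"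
      using \<eta> by simp
  qed (simp add: bounded_2_cocycle_group_def bounded_2_coboundaries_add)
qed

lemma group_second_bounded_cohomology: "group (second_bounded_cohomology G)"
proof -
  interpret Z: comm_group "bounded_2_cocycle_group G"
    by (rule comm_group_bounded_2_cocycle_group)
  have "bounded_2_coboundaries G \<lhd> bounded_2_cocycle_group G"
    by (rule Z.subgroup_imp_normal[OF subgroup_bounded_2_coboundaries])
  then show ?thesis
    unfolding second_bounded_cohomology_def by (rule normal.factorgroup_is_group)
qed

end

end

theory Submission
  imports Defs "HOL-Analysis.Function_Topology"
begin

text \<open>A cocycle \<open>\<omega>\<close> is symmetric on commuting pairs, because \<open>\<omega>(a,b) - \<omega>(b,a)\<close> is additive in
  \<open>a\<close> on the centralizer of \<open>b\<close> and bounded.  If \<open>H\<close> commutes with \<open>H\<^sup>f\<close>, then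
  \<open>\<theta>(h) = h h\<^sup>f\<close> is a homomorphism on \<open>H\<close> and the symmetry gives
  \<open>\<omega>(\<theta> g, \<theta> h) = 2 \<omega>(g, h) + d\<psi>(g, h)\<close> with \<open>\<psi>\<close> bounded by \<open>3 \<parallel>\<omega>\<parallel>\<close>.  So on every finitely
  generated subgroup \<open>\<omega>\<close> agrees up to \<open>\<parallel>\<omega>\<parallel> / 2\<close> with the coboundary of a function bounded by
  \<open>3 \<parallel>\<omega>\<parallel> / 2\<close>.  By Tychonoff's theorem the same holds on \<open>G\<close>.  Iterating, \<open>\<omega>\<close> is uniformly
  approximated by coboundaries of functions bounded by \<open>3 \<parallel>\<omega>\<parallel>\<close>, and a second
  appeal to compactness makes \<open>\<omega>\<close> itself such a coboundary.\<close>

section \<open>Compactness for bounded primitives\<close>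

lemma compact_pointwise_bounded:
  fixes B :: real
  shows "compact {\<phi> :: 'a \<Rightarrow> real. \<forall>g. \<bar>\<phi> g\<bar> \<le> B}"
proof -
  have "compactin (product_topology (\<lambda>_::'a. euclidean :: real topology) UNIV)
      (\<Pi>\<^sub>E g\<in>UNIV. {-B..B})"
    by (simp add: compactin_PiE)
  moreover have "(\<Pi>\<^sub>E g\<in>UNIV. {-B..B}) = {\<phi> :: 'a \<Rightarrow> real. \<forall>g. \<bar>\<phi> g\<bar> \<le> B}"
    by (auto simp: PiE_def Pi_def abs_le_iff minus_le_iff[of B])
  ultimately show ?thesis
    by (simp add: euclidean_product_topology)
qed

text \<open>For fixed \<open>g\<close>, \<open>h\<close> and \<open>e\<close> the condition reads
  only three values of \<open>\<phi>\<close>, so it is closed in the product topology, and the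
  finite intersection property applies. The slack \<open>e\<close> lets approximate solutions on
  finite sets yield the exact bound \<open>D\<close>.\<close>

lemma primitive_compactness:
  fixes w :: "'a \<Rightarrow> 'a \<Rightarrow> real" and m :: "'a \<Rightarrow> 'a \<Rightarrow> 'a"
  assumes approx: "\<And>F e. finite F \<Longrightarrow> F \<subseteq> A \<Longrightarrow> e > 0 \<Longrightarrow>
      \<exists>\<phi>. (\<forall>g. \<bar>\<phi> g\<bar> \<le> B) \<and> (\<forall>g\<in>F. \<forall>h\<in>F. \<bar>w g h - (\<phi> g + \<phi> h - \<phi> (m g h))\<bar> \<le> D + e)"
  shows "\<exists>\<phi>. (\<forall>g. \<bar>\<phi> g\<bar> \<le> B) \<and> (\<forall>g\<in>A. \<forall>h\<in>A. \<bar>w g h - (\<phi> g + \<phi> h - \<phi> (m g h))\<bar> \<le> D)"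
proof -
  define K where "K = {\<phi> :: 'a \<Rightarrow> real. \<forall>g. \<bar>\<phi> g\<bar> \<le> B}"
  define S where "S = (\<lambda>(g, h, e). {\<phi> :: 'a \<Rightarrow> real. \<bar>w g h - (\<phi> g + \<phi> h - \<phi> (m g h))\<bar> \<le> D + e})"
  let ?I = "A \<times> A \<times> {0::real<..}"
  have "K \<inter> (\<Inter>i\<in>?I. S i) \<noteq> {}"
  proof (rule compact_imp_fip_image)
    show "compact K"
      unfolding K_def by (rule compact_pointwise_bounded)
    show "closed (S i)" for i
      by (auto simp: S_def split: prod.splits intro!: closed_Collect_le continuous_intros)
  next
    fix J assume J: "finite J" "J \<subseteq> ?I"
    define F where "F = fst ` J \<union> (fst \<circ> snd) ` J"
    \<comment> \<open>The least slack occurring in \<open>J\<close>; the extra 1 keeps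
      \<open>Min\<close> meaningful when \<open>J\<close> is empty.\<close>
    define e where "e = Min (insert 1 ((snd \<circ> snd) ` J))"
    have e: "e > 0"
      unfolding e_def using J by (subst Min_gr_iff) auto
    have F: "finite F" "F \<subseteq> A"
      unfolding F_def using J(1) by (auto simp: mem_Times_iff dest!: subsetD[OF J(2)])
    obtain \<phi> where \<phi>: "\<forall>g. \<bar>\<phi> g\<bar> \<le> B"
      "\<And>g h. g \<in> F \<Longrightarrow> h \<in> F \<Longrightarrow> \<bar>w g h - (\<phi> g + \<phi> h - \<phi> (m g h))\<bar> \<le> D + e"
      using approx[OF F e] by blast
    have "\<phi> \<in> S i" if "i \<in> J" for i
    proof -
      obtain g h d where i: "i = (g, h, d)" by (cases i)
      have "g \<in> F" "h \<in> F"
        unfolding F_def using that i by force+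
      moreover have "e \<le> d"
        unfolding e_def using that i J(1) by (intro Min_le) force+
      ultimately show ?thesis
        using \<phi>(2)[of g h] by (auto simp: S_def i)
    qed
    with \<phi>(1) show "K \<inter> (\<Inter>i\<in>J. S i) \<noteq> {}"
      unfolding K_def by blast
  qed
  then obtain \<phi> where \<phi>: "\<phi> \<in> K" "\<And>i. i \<in> ?I \<Longrightarrow> \<phi> \<in> S i"
    by blast
  have "\<bar>w g h - (\<phi> g + \<phi> h - \<phi> (m g h))\<bar> \<le> D" if "g \<in> A" "h \<in> A" for g h
  proof (rule field_le_epsilon)
    fix e :: real assume "e > 0"
    then show "\<bar>w g h - (\<phi> g + \<phi> h - \<phi> (m g h))\<bar> \<le> D + e"
      using \<phi>(2)[of "(g, h, e)"] that by (simp add: S_def)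
  qed
  with \<phi>(1) show ?thesis
    unfolding K_def by blast
qed

section \<open>Identities for bounded cocycles\<close>

text \<open>Nothing is demanded of \<open>w\<close> off the carrier, so subtracting a coboundary
  gives a new instance directly, with another constant.\<close>

locale bounded_cocycle = group G for G (structure) +
  fixes w :: "'a \<Rightarrow> 'a \<Rightarrow> real" and C :: real
  assumes bound: "g \<in> carrier G \<Longrightarrow> h \<in> carrier G \<Longrightarrow> \<bar>w g h\<bar> \<le> C"
    and cocycle: "x \<in> carrier G \<Longrightarrow> y \<in> carrier G \<Longrightarrow> z \<in> carrier G \<Longrightarrow>
      w y z - w (x \<otimes> y) z + w x (y \<otimes> z) - w x y = 0"
begin

lemma bound_nonneg: "0 \<le> C"
  using bound[OF one_closed one_closed] by linarith

text \<open>Add the cocycle identities at \<open>(a, a', b)\<close> and \<open>(b, a, a')\<close>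
  and subtract the one at \<open>(a, b, a')\<close>; the commutation relations cancel the remaining
  product terms.\<close>

lemma commutator_additive:
  assumes [simp]: "a \<in> carrier G" "a' \<in> carrier G" "b \<in> carrier G"
    and comm: "a \<otimes> b = b \<otimes> a" "a' \<otimes> b = b \<otimes> a'"
  shows "w (a \<otimes> a') b - w b (a \<otimes> a') = (w a b - w b a) + (w a' b - w b a')"
  using cocycle[of a a' b] cocycle[of b a a'] cocycle[of a b a'] by (simp add: comm)

lemma symmetric_on_commuting:
  assumes [simp]: "a \<in> carrier G" "b \<in> carrier G" and comm: "a \<otimes> b = b \<otimes> a"
  shows "w a b = w b a"
proof (rule ccontr)
  assume ne: "w a b \<noteq> w b a"
  have pow_comm: "a [^] n \<otimes> b = b \<otimes> a [^] n" for n :: nat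
    by (induction n) (simp_all, metis assms comm m_assoc nat_pow_closed)
  \<comment> \<open>Exponents start at 1, which makes the base case trivial.\<close>
  have pow: "w (a [^] Suc n) b - w b (a [^] Suc n) = real (Suc n) * (w a b - w b a)" for n
  proof (induction n)
    case (Suc n)
    then show ?case
      using commutator_additive[of "a [^] Suc n" a b] pow_comm[of "Suc n"] comm
      by (simp add: algebra_simps del: nat_pow_Suc add: nat_pow_Suc[of a "Suc n"])
  qed simp
  obtain n where n: "2 * C < real n * \<bar>w a b - w b a\<bar>"
    using reals_Archimedean3[of "\<bar>w a b - w b a\<bar>"] ne by auto
  have "real (Suc n) * \<bar>w a b - w b a\<bar> = \<bar>w (a [^] Suc n) b - w b (a [^] Suc n)\<bar>"
    unfolding pow by (simp add: abs_mult)
  also have "\<dots> \<le> 2 * C"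
    using bound[of "a [^] Suc n" b] bound[of b "a [^] Suc n"] by simp
  finally show False
    using n by (simp add: algebra_simps)
qed

text \<open>Four cocycle identities rebracket \<open>a b a' b'\<close> into
  \<open>a a' b b'\<close>. Swapping the inner pair leaves \<open>w b a' - w a' b\<close>, which
  vanishes by symmetry.\<close>

lemma product_of_commuting:
  assumes [simp]: "a \<in> carrier G" "b \<in> carrier G" "a' \<in> carrier G" "b' \<in> carrier G"
    and comm: "a' \<otimes> b = b \<otimes> a'"
  shows "w (a \<otimes> b) (a' \<otimes> b')
    = w a a' + w b b' + w (a \<otimes> a') (b \<otimes> b') - w a b - w a' b'"
proof -
  have "b \<otimes> (a' \<otimes> b') = a' \<otimes> (b \<otimes> b')"
    by (simp add: comm flip: m_assoc)
  then show ?thesis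
    using cocycle[of a b "a' \<otimes> b'"] cocycle[of b a' b'] cocycle[of a' b b']
      cocycle[of a a' "b \<otimes> b'"] symmetric_on_commuting[OF _ _ comm] comm
    by simp
qed

text \<open>Conjugation acts trivially on cohomology. The explicit primitive sends \<open>x\<close>
  to \<open>w f u - w x f\<close>, where \<open>u\<close> is the conjugate of \<open>x\<close> by
  \<open>f\<close>.\<close>

lemma conjugation:
  assumes [simp]: "f \<in> carrier G" "u \<in> carrier G" "v \<in> carrier G" "x \<in> carrier G" "y \<in> carrier G"
    and conj: "f \<otimes> u = x \<otimes> f" "f \<otimes> v = y \<otimes> f"
  shows "w u v = w x y + (w f u - w x f) + (w f v - w y f) - (w f (u \<otimes> v) - w (x \<otimes> y) f)"
  using cocycle[of f u v] cocycle[of x f v] cocycle[of x y f] by (simp add: conj)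

section \<open>Halving a cocycle\<close>

lemma halving_on_subgroup:
  assumes H: "subgroup H G" and f: "f \<in> carrier G"
    and comm: "\<And>x y. x \<in> H \<Longrightarrow> y \<in> H \<Longrightarrow> x \<otimes> (inv f \<otimes> y \<otimes> f) = (inv f \<otimes> y \<otimes> f) \<otimes> x"
  shows "\<exists>\<phi>. (\<forall>g. \<bar>\<phi> g\<bar> \<le> 3 * C / 2) \<and>
    (\<forall>g\<in>H. \<forall>h\<in>H. \<bar>w g h - (\<phi> g + \<phi> h - \<phi> (g \<otimes> h))\<bar> \<le> C / 2)"
proof -
  define u where "u h = inv f \<otimes> h \<otimes> f" for h
  have HG: "h \<in> carrier G" if "h \<in> H" for h
    using H that by (rule subgroup.mem_carrier)
  have u_closed: "u h \<in> carrier G" if "h \<in> carrier G" for h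
    using that f by (simp add: u_def)
  have fu: "f \<otimes> u h = h \<otimes> f" if "h \<in> carrier G" for h
    using that f by (simp add: u_def flip: m_assoc)
  have u_mult: "u (g \<otimes> h) = u g \<otimes> u h" if "g \<in> carrier G" "h \<in> carrier G" for g h
  proof -
    note [simp] = that f u_closed
    have "f \<otimes> (u g \<otimes> u h) = f \<otimes> u g \<otimes> u h"
      by (simp add: m_assoc)
    also have "\<dots> = g \<otimes> (f \<otimes> u h)"
      unfolding fu[OF that(1)] by (simp add: m_assoc)
    also have "\<dots> = f \<otimes> u (g \<otimes> h)"
      by (simp add: fu m_assoc)
    finally show ?thesis by simp
  qed
  \<comment> \<open>The first two terms are the primitive from \<open>conjugation\<close>, the last
    is the correction from \<open>product_of_commuting\<close>. Three values of \<open>w\<close>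
    give the bound \<open>3 * C\<close>.\<close>
  define \<psi> where "\<psi> h = w f (u h) - w h f - w h (u h)" for h
  \<comment> \<open>Solving \<open>\<theta>^* w = 2 w + d\<psi>\<close> for \<open>w\<close> gives
    the factor -1/2 and the remainder \<open>\<theta>^* w / 2\<close>. The value 0 off the carrier
    makes the bound hold for all \<open>g\<close>.\<close>
  define \<phi> where "\<phi> h = (if h \<in> carrier G then - \<psi> h / 2 else 0)" for h
  have "\<bar>\<phi> g\<bar> \<le> 3 * C / 2" for g
  proof (cases "g \<in> carrier G")
    case True
    then show ?thesis
      using bound[of f "u g"] bound[of g f] bound[of g "u g"] f u_closed[of g]
      by (simp add: \<phi>_def \<psi>_def)
  qed (use bound_nonneg in \<open>simp add: \<phi>_def\<close>)
  moreover have "\<bar>w g h - (\<phi> g + \<phi> h - \<phi> (g \<otimes> h))\<bar> \<le> C / 2" if gh: "g \<in> H" "h \<in> H" for g h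
  proof -
    note carr = HG[OF gh(1)] HG[OF gh(2)]
    note u_carr = carr[THEN u_closed]
    \<comment> \<open>The inner pair to be swapped is \<open>u g\<close> and \<open>h\<close>, hence
      the reversed order in \<open>comm\<close>.\<close>
    have "w (g \<otimes> u g) (h \<otimes> u h) = w g h + w (u g) (u h) + w (g \<otimes> h) (u g \<otimes> u h)
        - w g (u g) - w h (u h)"
      using comm[OF gh(2,1)] by (intro product_of_commuting) (auto simp: u_def[symmetric] carr u_carr)
    moreover have "w (u g) (u h) = w g h + (w f (u g) - w g f) + (w f (u h) - w h f)
        - (w f (u g \<otimes> u h) - w (g \<otimes> h) f)"
      by (intro conjugation) (auto simp: carr u_carr f fu)
    ultimately have "w (g \<otimes> u g) (h \<otimes> u h) = 2 * w g h + \<psi> g + \<psi> h - \<psi> (g \<otimes> h)"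
      unfolding \<psi>_def u_mult[OF carr] by linarith
    moreover have "\<bar>w (g \<otimes> u g) (h \<otimes> u h)\<bar> \<le> C"
      by (intro bound) (simp_all add: carr u_carr)
    ultimately show ?thesis
      using carr by (simp add: \<phi>_def abs_le_iff field_simps)
  qed
  ultimately show ?thesis by blast
qed

text \<open>The element \<open>f\<close> and the primitive vary with the finite set
  \<open>F\<close>, but both bounds depend only on \<open>C\<close>, so compactness applies.\<close>

lemma halving:
  assumes "commuting_conjugates G"
  shows "\<exists>\<phi>. (\<forall>g. \<bar>\<phi> g\<bar> \<le> 3 * C / 2) \<and>
    (\<forall>g\<in>carrier G. \<forall>h\<in>carrier G. \<bar>w g h - (\<phi> g + \<phi> h - \<phi> (g \<otimes> h))\<bar> \<le> C / 2)"
proof (rule primitive_compactness)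
  fix F :: "'a set" and e :: real
  assume F: "finite F" "F \<subseteq> carrier G" and "e > 0"
  let ?H = "generate G F"
  have H: "subgroup ?H G"
    using F(2) by (rule generate_is_subgroup)
  then have "finitely_generated_subgroup G ?H"
    using F unfolding finitely_generated_subgroup_def by blast
  with assms have "\<exists>f\<in>carrier G. \<forall>x\<in>?H. \<forall>y\<in>(inv f <# ?H) #> f. x \<otimes> y = y \<otimes> x"
    unfolding commuting_conjugates_def by simp
  then obtain f where f: "f \<in> carrier G"
    "\<And>x y. x \<in> ?H \<Longrightarrow> y \<in> (inv f <# ?H) #> f \<Longrightarrow> x \<otimes> y = y \<otimes> x"
    by blast
  have "x \<otimes> (inv f \<otimes> y \<otimes> f) = (inv f \<otimes> y \<otimes> f) \<otimes> x" if "x \<in> ?H" "y \<in> ?H" for x y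
    using that by (intro f(2)) (auto simp: l_coset_def r_coset_def)
  from halving_on_subgroup[OF H f(1) this] obtain \<phi> where "\<forall>g. \<bar>\<phi> g\<bar> \<le> 3 * C / 2"
    "\<forall>g\<in>?H. \<forall>h\<in>?H. \<bar>w g h - (\<phi> g + \<phi> h - \<phi> (g \<otimes> h))\<bar> \<le> C / 2"
    by blast
  moreover have "F \<subseteq> ?H"
    by (auto intro: generate.incl)
  ultimately show "\<exists>\<phi>. (\<forall>g. \<bar>\<phi> g\<bar> \<le> 3 * C / 2) \<and>
      (\<forall>g\<in>F. \<forall>h\<in>F. \<bar>w g h - (\<phi> g + \<phi> h - \<phi> (g \<otimes> h))\<bar> \<le> C / 2 + e)"
    using \<open>e > 0\<close> by (intro exI[of _ \<phi>]) (simp add: subset_iff add_increasing2)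
qed

end

section \<open>Iteration and vanishing\<close>

text \<open>Halve once, then apply the induction hypothesis to the remainder, a cocycle with
  constant \<open>C / 2\<close>. The bound \<open>3 * C\<close> reproduces itself because
  \<open>3 * C / 2 + 3 * (C / 2) = 3 * C\<close>.\<close>

lemma (in group) approximate_primitive:
  assumes "commuting_conjugates G" and "bounded_cocycle G w C"
  shows "\<exists>\<phi>. (\<forall>g. \<bar>\<phi> g\<bar> \<le> 3 * C) \<and>
    (\<forall>g\<in>carrier G. \<forall>h\<in>carrier G. \<bar>w g h - (\<phi> g + \<phi> h - \<phi> (g \<otimes> h))\<bar> \<le> C / 2 ^ n)"
  using assms(2)
proof (induction n arbitrary: w C)
  case 0
  interpret bounded_cocycle G w C by fact
  show ?case
    using bound bound_nonneg by (intro exI[of _ "\<lambda>_. 0"]) auto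
next
  case (Suc n)
  interpret bounded_cocycle G w C by fact
  from halving[OF assms(1)] obtain \<phi> where \<phi>: "\<And>g. \<bar>\<phi> g\<bar> \<le> 3 * C / 2"
    "\<And>g h. g \<in> carrier G \<Longrightarrow> h \<in> carrier G \<Longrightarrow> \<bar>w g h - (\<phi> g + \<phi> h - \<phi> (g \<otimes> h))\<bar> \<le> C / 2"
    by blast
  let ?w = "\<lambda>g h. w g h - (\<phi> g + \<phi> h - \<phi> (g \<otimes> h))"
  have "bounded_cocycle G ?w (C / 2)"
  proof (unfold_locales, goal_cases)
    case (2 x y z)
    then show ?case
      using cocycle[of x y z] by (simp add: m_assoc)
  qed (use \<phi>(2) in auto)
  from Suc.IH[OF this] obtain \<psi> where \<psi>: "\<And>g. \<bar>\<psi> g\<bar> \<le> 3 * (C / 2)"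
    "\<And>g h. g \<in> carrier G \<Longrightarrow> h \<in> carrier G \<Longrightarrow>
      \<bar>?w g h - (\<psi> g + \<psi> h - \<psi> (g \<otimes> h))\<bar> \<le> C / 2 / 2 ^ n"
    by blast
  have "\<bar>\<phi> g + \<psi> g\<bar> \<le> 3 * C" for g
    using \<phi>(1)[of g] \<psi>(1)[of g] by linarith
  then show ?case
    using \<psi>(2) by (intro exI[of _ "\<lambda>g. \<phi> g + \<psi> g"]) (simp add: algebra_simps)
qed

text \<open>The bound on the approximate primitives is independent of \<open>n\<close>, so
  compactness with \<open>D = 0\<close> turns arbitrarily small errors into equality.\<close>

lemma (in bounded_cocycle) bounded_primitive:
  assumes "commuting_conjugates G"
  shows "\<exists>\<phi>. (\<forall>g. \<bar>\<phi> g\<bar> \<le> 3 * C) \<and>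
    (\<forall>g\<in>carrier G. \<forall>h\<in>carrier G. w g h = \<phi> g + \<phi> h - \<phi> (g \<otimes> h))"
proof -
  have "\<exists>\<phi>. (\<forall>g. \<bar>\<phi> g\<bar> \<le> 3 * C) \<and>
    (\<forall>g\<in>carrier G. \<forall>h\<in>carrier G. \<bar>w g h - (\<phi> g + \<phi> h - \<phi> (g \<otimes> h))\<bar> \<le> 0)"
  proof (rule primitive_compactness)
    fix F :: "'a set" and e :: real
    assume F: "F \<subseteq> carrier G" and e: "e > 0"
    obtain n where n: "C / e < 2 ^ n"
      using real_arch_pow[of 2 "C / e"] by auto
    then have "C / 2 ^ n \<le> 0 + e"
      using e by (simp add: field_simps)
    moreover obtain \<phi> where "\<forall>g. \<bar>\<phi> g\<bar> \<le> 3 * C"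
      "\<forall>g\<in>carrier G. \<forall>h\<in>carrier G. \<bar>w g h - (\<phi> g + \<phi> h - \<phi> (g \<otimes> h))\<bar> \<le> C / 2 ^ n"
      using approximate_primitive[OF assms bounded_cocycle_axioms] by blast
    ultimately show "\<exists>\<phi>. (\<forall>g. \<bar>\<phi> g\<bar> \<le> 3 * C) \<and>
        (\<forall>g\<in>F. \<forall>h\<in>F. \<bar>w g h - (\<phi> g + \<phi> h - \<phi> (g \<otimes> h))\<bar> \<le> 0 + e)"
      using F by (intro exI[of _ \<phi>]) (meson order_trans subsetD)
  qed
  then show ?thesis by simp
qed

lemma (in group) bounded_2_cocycles_eq_coboundaries:
  assumes "commuting_conjugates G"
  shows "bounded_2_cocycles G = bounded_2_coboundaries G"
proof
  show "bounded_2_cocycles G \<subseteq> bounded_2_coboundaries G"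
  proof
    fix \<omega> assume "\<omega> \<in> bounded_2_cocycles G"
    then obtain C where \<omega>: "\<omega> \<in> extensional (carrier G \<times> carrier G)"
      and C: "\<forall>g\<in>carrier G. \<forall>h\<in>carrier G. \<bar>\<omega> (g, h)\<bar> \<le> C"
      and cocycle: "\<forall>g1\<in>carrier G. \<forall>g2\<in>carrier G. \<forall>g3\<in>carrier G.
        \<omega> (g2, g3) - \<omega> (g1 \<otimes> g2, g3) + \<omega> (g1, g2 \<otimes> g3) - \<omega> (g1, g2) = 0"
      unfolding bounded_2_cocycles_iff by blast
    interpret bounded_cocycle G "\<lambda>g h. \<omega> (g, h)" C
      by unfold_locales (use C cocycle in blast)+
    obtain \<phi> where \<phi>: "\<forall>g. \<bar>\<phi> g\<bar> \<le> 3 * C"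
      "\<forall>g\<in>carrier G. \<forall>h\<in>carrier G. \<omega> (g, h) = \<phi> g + \<phi> h - \<phi> (g \<otimes> h)"
      using bounded_primitive[OF assms] by blast
    have "\<omega> = (\<lambda>(g, h)\<in>carrier G \<times> carrier G. \<phi> g + \<phi> h - \<phi> (g \<otimes> h))"
      using \<phi>(2) by (intro extensionalityI[OF \<omega>]) auto
    moreover have "bounded (\<phi> ` carrier G)"
      using \<phi>(1) by (auto simp: bounded_iff)
    ultimately show "\<omega> \<in> bounded_2_coboundaries G"
      unfolding bounded_2_coboundaries_def by blast
  qed
qed (rule bounded_2_coboundaries_subset)

theorem theorem1p2:
  fixes G :: "('a, 'b) monoid_scheme"
  assumes "group G"
    and "commuting_conjugates G"
  shows "trivial_group (second_bounded_cohomology G)"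
proof -
  interpret group G by fact
  interpret Z: comm_group "bounded_2_cocycle_group G"
    by (rule comm_group_bounded_2_cocycle_group)
  have carr: "carrier (bounded_2_cocycle_group G) = bounded_2_coboundaries G"
    using bounded_2_cocycles_eq_coboundaries[OF assms(2)] by (simp add: bounded_2_cocycle_group_def)
  \<comment> \<open>Every cocycle lies in the subgroup of coboundaries, so its coset is that
    subgroup, the identity of the quotient.\<close>
  have "carrier (second_bounded_cohomology G) \<subseteq> {\<one>\<^bsub>second_bounded_cohomology G\<^esub>}"
    unfolding second_bounded_cohomology_def carrier_FactGroup one_FactGroup
    using Z.coset_join2[OF _ subgroup_bounded_2_coboundaries] carr by blast
  then show ?thesis
    by (simp add: group.trivial_group_subset[OF group_second_bounded_cohomology])
qed

end
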